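(* Let $n,d$ be positive integers, and let $\mathcal{F}\subseteq \binom{[n]}{d+1}$ be a family of maximum size subject to $\mathrm{VC}(\mathcal{F})\le d$. Then $$\binom{n-1}{d}+\binom{n-4}{d-2}\le |\mathcal{F}|\le \binom{n-1}{d}+O(n^{d-2}).$$
   Context: $[n]=\{1,\dots,n\}$ and $\binom{X}{k}$ denotes the family of all $k$-element subsets of a set $X$. A set $S\subseteq [n]$ is shattered by a family $\mathcal{F}\subseteq 2^{[n]}$ if for every $A\subseteq S$ (including $A=\emptyset$ and $A=S$) there is $F\in\mathcal{F}$ with $F\cap S=A$. The VC-dimension $\mathrm{VC}(\mathcal{F})$ is the largest size of a set shattered by $\mathcal{F}$; thus $\mathrm{VC}(\mathcal{F})\le d$ means that no subset of $[n]$ of size greater than $d$ is shattered by $\mathcal{F}$. The constant implied by $O(\cdot)$ depends only on $d$: there is a constant $C_d$ such that the upper bound holds with $O(n^{d-2})$ replaced by $C_d n^{d-2}$. A binomial coefficient $\binom{a}{b}$ is taken to be $0$ when $b<0$, $a<0$ or $a<b$. *)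

theory Defs
  imports Complex_Main "HOL-Library.Ramsey"
begin

definition shatters :: "'a set set \<Rightarrow> 'a set \<Rightarrow> bool" where
  "shatters F S \<longleftrightarrow> (\<forall>A\<subseteq>S. \<exists>X\<in>F. X \<inter> S = A)"

text \<open>
  The supremum is over a finite set of natural numbers, so it is a maximum whenever some set is
  shattered.  The empty family shatters nothing; as \<open>Sup {} = 0\<close> on \<^typ>\<open>nat\<close>, its VC-dimension is
  \<open>0\<close> here, so that the characterisation \<open>vc_dim_le_iff\<close> holds for every family.
\<close>

definition vc_dim :: "nat \<Rightarrow> nat set set \<Rightarrow> nat" where
  "vc_dim n F = Sup (card ` {S. S \<subseteq> {1..n} \<and> shatters F S})"

lemma vc_dim_le_iff:
  "vc_dim n F \<le> d \<longleftrightarrow> (\<forall>S\<subseteq>{1..n}. shatters F S \<longrightarrow> card S \<le> d)"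
proof -
  let ?K = "card ` {S. S \<subseteq> {1..n} \<and> shatters F S}"
  have "finite ?K" by simp
  then have "bdd_above ?K" by (rule bdd_above_finite)
  then have "Sup ?K \<le> d \<longleftrightarrow> (\<forall>k\<in>?K. k \<le> d)"
    by (cases "?K = {}") (auto simp: Sup_nat_def cSup_le_iff)
  then show ?thesis by (auto simp: vc_dim_def)
qed

text \<open>
  Binomial coefficient with integer arguments, equal to \<open>0\<close> if \<open>b < 0\<close>, \<open>a < 0\<close> or \<open>a < b\<close>.
  Truncated subtraction on \<^typ>\<open>nat\<close> would instead give \<open>(n - 4) choose (d - 2) = 1\<close> for
  \<open>n < 4\<close>, \<open>d \<le> 2\<close>, and \<^const>\<open>gbinomial\<close> does not vanish for negative upper argument.
\<close>

definition binom :: "int \<Rightarrow> int \<Rightarrow> nat" where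
  "binom a b = (if 0 \<le> b \<and> b \<le> a then nat a choose nat b else 0)"

end

theory Submission
  imports Defs
begin

text \<open>
  A set \<open>B\<close> properly contained in a member \<open>X\<close> is missing if \<open>Y \<inter> X = B\<close> for no member \<open>Y\<close>.  A
  \<open>(d + 1)\<close>-uniform family has VC-dimension at most \<open>d\<close> exactly when every member has a missing set.
  The lower bound comes from the family of Ahlswede and Khachatrian, a modification of the star of
  all sets through one point.

  For the upper bound choose a maximal missing set, the core, in every member.  Maximality leaves
  room for only boundedly many members with a given core (\<open>card_same_core\<close>), so all but \<open>O(n^(d-2))\<close>
  members have a core of size \<open>d\<close> or \<open>d - 1\<close>.  A missing set of size \<open>d\<close> lies in no second member; the
  members that have one are called own.  The others, with a core \<open>B\<close> of size \<open>d - 1\<close>, are called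
  paired, because they have the form \<open>B \<union> {p, q}\<close>.

  Own members are counted as in Bollobas's set-pair inequality.  There are
  \<open>(n - d) (n choose d) = n ((n - 1) choose d)\<close> pairs \<open>(D, v)\<close> of a \<open>d\<close>-set \<open>D\<close> and a point \<open>v \<notin> D\<close>.
  Each own member uses up exactly \<open>n\<close> of them: the \<open>n - d\<close> pairs in which \<open>D\<close> is its chosen missing
  \<open>d\<close>-set and the \<open>d\<close> other pairs with \<open>D \<union> {v}\<close> equal to it (\<open>slack_identity\<close>).  The unused pairs
  are the slack, and the theorem follows once the slack is shown to be at least \<open>n\<close> times the number
  of paired members, up to \<open>O(n^(d-1))\<close> (\<open>card_paired_le_slack\<close>).

  A paired member \<open>X = B \<union> {p, q}\<close> is charged to slack pairs as follows.  For \<open>v \<notin> X\<close> suppose that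
  \<open>B \<union> {v}\<close> is the chosen missing \<open>d\<close>-set of an own member \<open>Y\<close>.  As \<open>B\<close> is missing in \<open>X\<close>, \<open>Y\<close> contains
  \<open>p\<close> or \<open>q\<close>, say \<open>Y = B \<union> {v, p}\<close>; then \<open>(B \<union> {q}, v)\<close> is a slack pair.  The supposition fails for
  only \<open>O(n^(d-1))\<close> pairs \<open>(X, v)\<close>, or else the slack is already large enough.

  Two charges can collide.  Then there are a \<open>(d - 2)\<close>-set \<open>C\<close> and members \<open>C \<union> {x, x', a}\<close> with core
  \<open>C \<union> {x}\<close> and \<open>C \<union> {x, x', b}\<close> with core \<open>C \<union> {x'}\<close>, where \<open>a \<noteq> b\<close>.  If \<open>t\<close> points \<open>x\<close> occur in this
  way for the same \<open>C\<close>, then for all but \<open>O(t)\<close> pairs of such points \<open>x\<close>, \<open>y\<close> one of the \<open>d\<close>-sets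
  \<open>C \<union> {x, y}\<close> and \<open>C \<union> {x, y'}\<close> lies in no member at all (\<open>clash_uncovered\<close>).  Every such uncovered
  set contributes \<open>n - d\<close> slack pairs that receive no charge, and there are of the order of \<open>t^2\<close> of
  them, against only \<open>O(t n)\<close> collisions.  So apart from boundedly many \<open>x\<close> for each \<open>C\<close> the uncovered
  sets pay for the collisions.
\<close>

section \<open>Counting finite sets\<close>

lemma card_le_image_plus_collisions:
  assumes "finite S"
  shows "card S \<le> card (f ` S) + card {s \<in> S. \<exists>t\<in>S. t \<noteq> s \<and> f t = f s}"
    (is "_ \<le> _ + card ?K")
proof -
  have "inj_on f (S - ?K)" by (auto intro!: inj_onI)
  then have "card (S - ?K) = card (f ` (S - ?K))" by (simp add: card_image)
  also have "\<dots> \<le> card (f ` S)" using assms by (intro card_mono) auto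
  finally have "card (S - ?K) \<le> card (f ` S)" .
  moreover have "card ?K \<le> card S" using assms by (intro card_mono) auto
  then have "card S = card (S - ?K) + card ?K"
    using assms by (simp add: card_Diff_subset)
  ultimately show ?thesis by simp
qed

lemma card_UN_bounded:
  assumes "finite I" and "\<And>i. i \<in> I \<Longrightarrow> card (A i) \<le> k"
  shows "card (\<Union>i\<in>I. A i) \<le> card I * k"
proof -
  have "card (\<Union>i\<in>I. A i) \<le> (\<Sum>i\<in>I. card (A i))" using assms by (intro card_UN_le)
  also have "\<dots> \<le> card I * k" using sum_bounded_above[of I "\<lambda>i. card (A i)" k] assms by simp
  finally show ?thesis .
qed

lemma choose_le_power: "n choose k \<le> n ^ k"
  by (cases "k \<le> n") (auto simp: binomial_le_pow binomial_eq_0)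

section \<open>Missing sets and cores\<close>

locale uniform_vc_family =
  fixes V :: "'a set" and d :: nat and F :: "'a set set"
  assumes finite_V: "finite V"
    and d_pos: "d \<ge> 1"
    and uniform: "F \<subseteq> nsets V (d + 1)"
    and unshattered: "\<And>X. X \<in> F \<Longrightarrow> \<exists>B\<subset>X. \<forall>Y\<in>F. Y \<inter> X \<noteq> B"
begin

abbreviation n :: nat where "n \<equiv> card V"

lemma memberD:
  assumes "X \<in> F"
  shows "X \<subseteq> V" and "finite X" and "card X = Suc d"
  using assms uniform by (auto simp: nsets_def)

lemma finite_F: "finite F"
  by (rule finite_subset[OF uniform finite_imp_finite_nsets[OF finite_V]])

definition missing :: "'a set \<Rightarrow> 'a set \<Rightarrow> bool" where
  "missing X B \<longleftrightarrow> B \<subset> X \<and> (\<forall>Y\<in>F. Y \<inter> X \<noteq> B)"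

text \<open>
  A set of size \<open>d\<close> that is missing in \<open>X\<close> lies in no member other than \<open>X\<close>, because \<open>Y \<inter> X\<close> would lie
  strictly between it and \<open>X\<close>.
\<close>
definition own :: "'a set set" where
  "own = {X \<in> F. \<exists>A. missing X A \<and> card A = d}"

definition own_face :: "'a set \<Rightarrow> 'a set" where
  "own_face X = (SOME A. missing X A \<and> card A = d)"

lemma own_faceD:
  assumes "X \<in> own"
  shows "own_face X \<subset> X" and "card (own_face X) = d"
    and "\<And>Y. Y \<in> F \<Longrightarrow> own_face X \<subseteq> Y \<Longrightarrow> Y = X"
proof -
  have X: "X \<in> F" and "\<exists>A. missing X A \<and> card A = d" using assms by (auto simp: own_def)
  from this(2) have A: "missing X (own_face X) \<and> card (own_face X) = d"
    unfolding own_face_def by (rule someI_ex)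
  then have miss: "own_face X \<subset> X" "\<And>Y. Y \<in> F \<Longrightarrow> Y \<inter> X \<noteq> own_face X" and c: "card (own_face X) = d"
    by (simp_all add: missing_def)
  show "own_face X \<subset> X" and "card (own_face X) = d" by fact+
  fix Y assume Y: "Y \<in> F" "own_face X \<subseteq> Y"
  have "own_face X \<subset> Y \<inter> X" using miss(1) miss(2)[OF Y(1)] Y(2) by blast
  then have "d < card (Y \<inter> X)"
    using c memberD(2)[OF X] psubset_card_mono[of "Y \<inter> X" "own_face X"] by simp
  then have "Y \<inter> X = X" and "Y \<inter> X = Y"
    using memberD[OF X] memberD[OF Y(1)] card_seteq[of X "Y \<inter> X"] card_seteq[of Y "Y \<inter> X"] by auto
  then show "Y = X" by blast
qed

lemma own_subset: "own \<subseteq> F" by (auto simp: own_def)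

lemma finite_own: "finite own" using finite_F own_subset finite_subset by blast

definition owned :: "'a set set" where "owned = own_face ` own"

lemma inj_own_face: "inj_on own_face own"
  proof (rule inj_onI)
  fix X Y assume "X \<in> own" "Y \<in> own" "own_face X = own_face Y"
  then show "X = Y" using own_faceD(3)[of X Y] own_faceD(1)[of Y] own_subset by auto
qed

lemma card_owned: "card owned = card own"
  unfolding owned_def using inj_own_face by (rule card_image)

lemma owned_subset: "owned \<subseteq> nsets V d"
proof
  fix A assume "A \<in> owned"
  then obtain X where X: "X \<in> own" "A = own_face X" by (auto simp: owned_def)
  then have "A \<subseteq> X" "X \<subseteq> V" "finite X" "card A = d"
    using own_faceD[OF X(1)] memberD[of X] own_subset by auto
  then show "A \<in> nsets V d" by (auto simp: nsets_def intro: finite_subset)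
qed

definition core :: "'a set \<Rightarrow> 'a set" where
  "core X = (SOME B. missing X B \<and> (\<forall>B'. missing X B' \<longrightarrow> \<not> B \<subset> B'))"

lemma coreD:
  assumes "X \<in> F"
  shows "core X \<subset> X" and "\<And>Y. Y \<in> F \<Longrightarrow> Y \<inter> X \<noteq> core X"
    and "\<And>B. core X \<subset> B \<Longrightarrow> B \<subset> X \<Longrightarrow> \<exists>Y\<in>F. Y \<inter> X = B"
proof -
  let ?M = "{B. missing X B}"
  have "finite ?M"
    by (rule finite_subset[of _ "Pow X"]) (use memberD[OF assms] in \<open>auto simp: missing_def\<close>)
  moreover have "?M \<noteq> {}" using unshattered[OF assms] by (auto simp: missing_def)
  ultimately have "\<exists>B\<in>?M. \<forall>B'\<in>?M. B \<subseteq> B' \<longrightarrow> B = B'" by (rule finite_has_maximal)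
  then obtain B where "missing X B" and max: "\<And>B'. missing X B' \<Longrightarrow> B \<subseteq> B' \<Longrightarrow> B = B'"
    by (elim bexE) simp
  moreover have "\<not> B \<subset> B'" if "missing X B'" for B'
    using max[OF that] by (simp add: psubset_eq)
  ultimately have "\<exists>B. missing X B \<and> (\<forall>B'. missing X B' \<longrightarrow> \<not> B \<subset> B')" by iprover
  then have "missing X (core X) \<and> (\<forall>B'. missing X B' \<longrightarrow> \<not> core X \<subset> B')"
    unfolding core_def by (rule someI_ex)
  then have R: "missing X (core X)" "\<And>B'. missing X B' \<Longrightarrow> \<not> core X \<subset> B'" by iprover+
  then show "core X \<subset> X" and "\<And>Y. Y \<in> F \<Longrightarrow> Y \<inter> X \<noteq> core X" by (simp_all add: missing_def)
  show "\<exists>Y\<in>F. Y \<inter> X = B" if "core X \<subset> B" "B \<subset> X" for B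
    using R(2)[of B] that by (auto simp: missing_def)
qed

lemma core_meets:
  assumes "X \<in> F" and "Y \<in> F" and "core X \<subseteq> Y"
  obtains z where "z \<in> X" and "z \<in> Y" and "z \<notin> core X"
proof -
  have "Y \<inter> X \<noteq> core X" and "core X \<subseteq> X" using coreD[OF assms(1)] assms(2) by auto
  then have "\<exists>z. z \<in> X \<and> z \<in> Y \<and> z \<notin> core X" using assms(3) by blast
  then show thesis using that by blast
qed

text \<open>
  A member \<open>X0\<close> with core \<open>B\<close> that contains \<open>K\<close> yields a member \<open>Y\<close> with \<open>Y \<inter> K = B\<close>: the set
  \<open>B \<union> (X0 - K)\<close> is strictly larger than the maximal missing set \<open>B\<close>, hence a trace on \<open>X0\<close>.  Every
  member with core \<open>B\<close> containing \<open>K\<close> must meet \<open>Y\<close> outside \<open>B\<close>, so it contains one of the at most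
  \<open>d + 1\<close> points of \<open>Y - K\<close>, and \<open>K\<close> can be enlarged by that point.
\<close>
lemma card_same_core_above:
  assumes "B \<subseteq> K" and "card K \<le> Suc d" and "finite K"
  shows "card {X \<in> F. core X = B \<and> K \<subseteq> X} \<le> Suc d ^ (Suc d - card K)"
  using assms
proof (induction "Suc d - card K" arbitrary: K)
  case 0
  have "X = K" if "X \<in> F" "K \<subseteq> X" for X
    using that 0 memberD[OF that(1)] by (intro card_subset_eq[symmetric]) auto
  then have "{X \<in> F. core X = B \<and> K \<subseteq> X} \<subseteq> {K}" by auto
  then have "card {X \<in> F. core X = B \<and> K \<subseteq> X} \<le> card {K}" by (intro card_mono) auto
  also have "\<dots> = Suc d ^ (Suc d - card K)" using 0 by simp
  finally show ?case .
next
  case (Suc m)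
  show ?case
  proof (cases "{X \<in> F. core X = B \<and> K \<subseteq> X} = {}")
    case True
    then show ?thesis by (simp only: card.empty)
  next
    case False
    then obtain X0 where X0: "X0 \<in> F" "core X0 = B" "K \<subseteq> X0" by auto
    have "\<exists>Y\<in>F. Y \<inter> K = B"
    proof (cases "K = B")
      case True
      \<comment> \<open>Here \<open>B \<union> (X0 - K)\<close> is \<open>X0\<close> itself, not a proper subset.\<close>
      then show ?thesis using X0 by (intro bexI[of _ X0]) auto
    next
      case False
      have "K \<noteq> X0" using Suc.hyps(2) memberD[OF X0(1)] by auto
      then have "core X0 \<subset> B \<union> (X0 - K)" "B \<union> (X0 - K) \<subset> X0"
        using X0 Suc.prems False by auto
      from coreD(3)[OF X0(1) this] obtain Y where "Y \<in> F" "Y \<inter> X0 = B \<union> (X0 - K)" ..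
      then show ?thesis using X0 Suc.prems by (intro bexI[of _ Y]) auto
    qed
    then obtain Y where Y: "Y \<in> F" "Y \<inter> K = B" by blast
    have "{X \<in> F. core X = B \<and> K \<subseteq> X} \<subseteq> (\<Union>z\<in>Y - K. {X \<in> F. core X = B \<and> insert z K \<subseteq> X})"
    proof
      fix X assume "X \<in> {X \<in> F. core X = B \<and> K \<subseteq> X}"
      then have X: "X \<in> F" "core X = B" "K \<subseteq> X" by auto
      then obtain z where "z \<in> X" "z \<in> Y" "z \<notin> B" using core_meets[OF X(1) Y(1)] Y by auto
      then show "X \<in> (\<Union>z\<in>Y - K. {X \<in> F. core X = B \<and> insert z K \<subseteq> X})" using X Y by auto
    qed
    then have "card {X \<in> F. core X = B \<and> K \<subseteq> X}
        \<le> card (\<Union>z\<in>Y - K. {X \<in> F. core X = B \<and> insert z K \<subseteq> X})"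
      by (rule card_mono[rotated]) (use finite_F memberD[OF Y(1)] in auto)
    also have "\<dots> \<le> card (Y - K) * Suc d ^ m"
    proof (rule card_UN_bounded)
      show "finite (Y - K)" using memberD[OF Y(1)] by auto
      fix z assume z: "z \<in> Y - K"
      then have c: "card (insert z K) = Suc (card K)" using Suc.prems by auto
      have "card {X \<in> F. core X = B \<and> insert z K \<subseteq> X} \<le> Suc d ^ (Suc d - card (insert z K))"
        using Suc.hyps(2) Suc.prems c by (intro Suc.hyps(1)) auto
      also have "Suc d - card (insert z K) = m" using Suc.hyps(2) c by simp
      finally show "card {X \<in> F. core X = B \<and> insert z K \<subseteq> X} \<le> Suc d ^ m" .
    qed
    also have "\<dots> \<le> Suc d * Suc d ^ m"
      using memberD[OF Y(1)] card_mono[of Y "Y - K"] by (intro mult_right_mono) auto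
    also have "\<dots> = Suc d ^ (Suc d - card K)" by (simp flip: Suc.hyps(2))
    finally show ?thesis .
  qed
qed

definition \<kappa> :: nat where "\<kappa> = Suc d ^ Suc d"

lemma card_same_core: "card {X \<in> F. core X = B} \<le> \<kappa>"
proof (cases "{X \<in> F. core X = B} = {}")
  case True
  then show ?thesis by (simp only: card.empty)
next
  case False
  then obtain X where X: "X \<in> F" "core X = B" by auto
  then have "B \<subseteq> X" "finite X" "card X = Suc d" using coreD(1)[OF X(1)] memberD[OF X(1)] by auto
  then have "finite B" "card B \<le> Suc d" using finite_subset card_mono[of X B] by auto
  then have "card {X \<in> F. core X = B \<and> B \<subseteq> X} \<le> Suc d ^ (Suc d - card B)"
    by (intro card_same_core_above) auto
  also have "{X \<in> F. core X = B \<and> B \<subseteq> X} = {X \<in> F. core X = B}" using coreD(1) by auto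
  also have "Suc d ^ (Suc d - card B) \<le> \<kappa>" unfolding \<kappa>_def by (intro power_increasing) auto
  finally show ?thesis .
qed

lemma card_le_cores:
  assumes "S \<subseteq> F" and "core ` S \<subseteq> R" and "finite R"
  shows "card S \<le> card R * \<kappa>"
proof -
  have "S \<subseteq> (\<Union>B\<in>R. {X \<in> F. core X = B})" using assms by auto
  then have "card S \<le> card (\<Union>B\<in>R. {X \<in> F. core X = B})"
    by (rule card_mono[rotated]) (use finite_F assms in auto)
  also have "\<dots> \<le> card R * \<kappa>" using assms card_same_core by (intro card_UN_bounded)
  finally show ?thesis .
qed

section \<open>Own and paired members\<close>

definition paired :: "'a set set" where
  "paired = {X \<in> F. X \<notin> own \<and> card (core X) + 1 = d}"

definition small_core :: "'a set set" where
  "small_core = {X \<in> F. X \<notin> own \<and> card (core X) + 2 \<le> d}"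

lemma card_core:
  assumes "X \<in> F" and "X \<notin> own"
  shows "card (core X) < d"
proof -
  have "card (core X) < Suc d"
    using coreD(1)[OF assms(1)] memberD[OF assms(1)] psubset_card_mono[of X] by metis
  moreover have "card (core X) \<noteq> d"
    using assms coreD(1,2)[OF assms(1)] unfolding own_def missing_def by blast
  ultimately show ?thesis by simp
qed

lemma F_decomposition: "card F = card own + card paired + card small_core"
proof -
  have "X \<in> own \<union> paired \<union> small_core" if "X \<in> F" for X
    using card_core[of X] that by (cases "X \<in> own") (auto simp: paired_def small_core_def)
  then have "F = own \<union> paired \<union> small_core"
    using own_subset by (auto simp: paired_def small_core_def)
  then have "card F = card (own \<union> paired \<union> small_core)" by (rule arg_cong)
  moreover have "own \<inter> paired = {}" "(own \<union> paired) \<inter> small_core = {}"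
    by (auto simp: paired_def small_core_def)
  moreover have "finite paired" "finite small_core"
    using finite_F by (auto simp: paired_def small_core_def)
  ultimately show ?thesis using finite_own by (simp only: card_Un_disjoint finite_Un simp_thms)
qed

lemma card_low: "n * card {C. C \<subseteq> V \<and> card C + 2 \<le> d} \<le> d * n ^ (d - 1)"
proof (cases "n = 0 \<or> d = 1")
  case True
  then show ?thesis by auto
next
  case False
  then have n: "n \<ge> 1" and d: "d \<ge> 2" using d_pos by auto
  have "{C. C \<subseteq> V \<and> card C + 2 \<le> d} \<subseteq> (\<Union>b\<in>{..<d - 1}. nsets V b)"
    using finite_V by (auto simp: nsets_def finite_subset)
  then have "card {C. C \<subseteq> V \<and> card C + 2 \<le> d} \<le> card (\<Union>b\<in>{..<d - 1}. nsets V b)"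
    by (rule card_mono[rotated]) (simp add: finite_imp_finite_nsets finite_V)
  also have "\<dots> \<le> card {..<d - 1} * n ^ (d - 2)"
  proof (rule card_UN_bounded)
    fix b assume "b \<in> {..<d - 1}"
    then have "n ^ b \<le> n ^ (d - 2)" using n by (intro power_increasing) auto
    then show "card (nsets V b) \<le> n ^ (d - 2)" using choose_le_power[of n b] by simp
  qed simp
  also have "\<dots> \<le> d * n ^ (d - 2)" by simp
  finally have "n * card {C. C \<subseteq> V \<and> card C + 2 \<le> d} \<le> n * (d * n ^ (d - 2))" by simp
  also have "\<dots> = d * n ^ (d - 1)"
  proof -
    have "d - 1 = Suc (d - 2)" using d by simp
    then show ?thesis by simp
  qed
  finally show ?thesis .
qed

lemma card_small_core: "n * card small_core \<le> d * \<kappa> * n ^ (d - 1)"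
proof -
  let ?R = "{C. C \<subseteq> V \<and> card C + 2 \<le> d}"
  have "core X \<subseteq> V" if "X \<in> F" for X
    using coreD(1)[OF that] memberD(1)[OF that] by blast
  then have "card small_core \<le> card ?R * \<kappa>"
    using finite_V by (intro card_le_cores) (auto simp: small_core_def)
  then have "n * card small_core \<le> (n * card ?R) * \<kappa>" by (simp add: mult.assoc)
  also have "\<dots> \<le> (d * n ^ (d - 1)) * \<kappa>" using card_low by (intro mult_right_mono) auto
  finally show ?thesis by (simp add: algebra_simps)
qed

lemma pairedD:
  assumes "X \<in> paired"
  shows "X \<in> F" and "X \<notin> own" and "finite (core X)" and "Suc (card (core X)) = d"
    and "core X \<subset> X" and "card (X - core X) = 2"
proof -
  show X: "X \<in> F" and "X \<notin> own" and c: "Suc (card (core X)) = d"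
    using assms by (auto simp: paired_def)
  show s: "core X \<subset> X" using coreD(1)[OF X] .
  then show f: "finite (core X)" using memberD[OF X] finite_subset by blast
  show "card (X - core X) = 2" using c s f memberD[OF X] by (subst card_Diff_subset) auto
qed

lemma card_paired: "card paired \<le> \<kappa> * n ^ (d - 1)"
proof -
  have "core ` paired \<subseteq> nsets V (d - 1)"
    using pairedD memberD(1) by (force simp: nsets_def)
  then have "card paired \<le> card (nsets V (d - 1)) * \<kappa>"
    using finite_V by (intro card_le_cores) (auto simp: paired_def finite_imp_finite_nsets)
  also have "\<dots> \<le> n ^ (d - 1) * \<kappa>" using choose_le_power[of n "d - 1"] by simp
  finally show ?thesis by (simp add: mult.commute)
qed

section \<open>The slack of the own members\<close>

definition slack :: "('a set \<times> 'a) set" where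
  "slack = (SIGMA D : nsets V d - owned. {v \<in> V - D. insert v D \<notin> own})"

lemma finite_slack: "finite slack"
  unfolding slack_def using finite_V by (intro finite_SigmaI) (auto simp: finite_imp_finite_nsets)

text \<open>
  The pairs \<open>(D, v)\<close> outside the slack split into those whose \<open>D\<close> is an own face and those whose \<open>D\<close>
  is none although \<open>D \<union> {v}\<close> is an own member.  The latter are obtained from an own member \<open>X\<close> by removing
  a point \<open>v\<close> of its own face: removing the remaining point of \<open>X\<close> gives the own face of \<open>X\<close>, and no
  other own face lies in \<open>X\<close>.
\<close>
lemma slack_identity: "card slack + n * card own = (n - d) * (n choose d)"
proof -
  let ?all = "SIGMA D : nsets V d. V - D"
  let ?T1 = "SIGMA D : owned. V - D"
  let ?T2 = "{(D, v). D \<in> nsets V d \<and> D \<notin> owned \<and> v \<in> V - D \<and> insert v D \<in> own}"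
  have fin: "finite (nsets V d)" using finite_V by (simp add: finite_imp_finite_nsets)
  have co: "card (V - D) = n - d" if "D \<in> nsets V d" for D
    using that finite_V by (auto simp: nsets_def card_Diff_subset)
  have all: "card ?all = (n - d) * (n choose d)"
    using fin finite_V co by (subst card_SigmaI) auto
  have T1: "card ?T1 = card own * (n - d)"
  proof -
    have "finite owned" using fin owned_subset finite_subset by blast
    then have "card ?T1 = (\<Sum>D\<in>owned. card (V - D))" using finite_V by (subst card_SigmaI) auto
    also have "\<dots> = (\<Sum>D\<in>owned. n - d)" using owned_subset co by (intro sum.cong) auto
    finally show ?thesis by (simp add: card_owned)
  qed
  have T2: "card ?T2 = card own * d"
  proof -
    have face: "X - {v} \<notin> owned" if "X \<in> own" "v \<in> own_face X" for X v
    proof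
      assume "X - {v} \<in> owned"
      then obtain Y where Y: "Y \<in> own" "X - {v} = own_face Y" by (auto simp: owned_def)
      then have "X = Y" using own_faceD(3)[OF Y(1), of X] that own_subset by auto
      then show False using Y that by auto
    qed
    have "bij_betw (\<lambda>(X, v). (X - {v}, v)) (SIGMA X : own. own_face X) ?T2"
    proof (rule bij_betw_byWitness[where f' = "\<lambda>(D, v). (insert v D, v)"])
      show "\<forall>a\<in>SIGMA X:own. own_face X. (case case a of (X, v) \<Rightarrow> (X - {v}, v) of (D, v) \<Rightarrow> (insert v D, v)) = a"
        using own_faceD(1) by auto
      show "\<forall>a'\<in>?T2. (case case a' of (D, v) \<Rightarrow> (insert v D, v) of (X, v) \<Rightarrow> (X - {v}, v)) = a'" by auto
      show "(\<lambda>(X, v). (X - {v}, v)) ` (SIGMA X:own. own_face X) \<subseteq> ?T2"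
      proof clarify
        fix X v assume X: "X \<in> own" "v \<in> own_face X"
        have "v \<in> X" and m: "X \<in> F" using own_faceD(1)[OF X(1)] X own_subset by auto
        then have "X - {v} \<in> nsets V d" "v \<in> V - (X - {v})" "insert v (X - {v}) \<in> own"
          using memberD[OF m] X by (auto simp: nsets_def insert_absorb)
        then show "X - {v} \<in> nsets V d \<and> X - {v} \<notin> owned \<and> v \<in> V - (X - {v}) \<and> insert v (X - {v}) \<in> own"
          using face[OF X] by simp
      qed
      show "(\<lambda>(D, v). (insert v D, v)) ` ?T2 \<subseteq> (SIGMA X:own. own_face X)"
      proof -
        have "v \<in> own_face (insert v D)"
          if D: "D \<in> nsets V d" "D \<notin> owned" "v \<in> V" "v \<notin> D" "insert v D \<in> own" for D v
        proof (rule ccontr)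
          let ?A = "own_face (insert v D)"
          assume "v \<notin> ?A"
          then have "?A \<subseteq> D" using own_faceD(1)[OF D(5)] by blast
          then have "?A = D" using own_faceD(2)[OF D(5)] D(1) by (intro card_subset_eq) (simp_all add: nsets_def)
          then show False using D by (auto simp: owned_def)
        qed
        then show ?thesis by auto
      qed
    qed
    then have "card ?T2 = card (SIGMA X : own. own_face X)" by (simp add: bij_betw_same_card)
    also have "\<dots> = (\<Sum>X\<in>own. card (own_face X))"
    proof (rule card_SigmaI)
      show "\<forall>X\<in>own. finite (own_face X)"
        using own_faceD(1) own_subset memberD(2) by (meson finite_subset psubset_imp_subset subsetD)
    qed (rule finite_own)
    also have "\<dots> = card own * d" using own_faceD(2) by simp
    finally show ?thesis .
  qed
  have f2: "finite ?T2" by (rule finite_subset[of _ ?all]) (use fin finite_V in auto)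
  have f1: "finite ?T1"
    using owned_subset fin finite_V by (intro finite_SigmaI) (auto intro: finite_subset)
  have "?all = slack \<union> ?T1 \<union> ?T2" using owned_subset by (auto simp: slack_def)
  then have "card ?all = card (slack \<union> ?T1 \<union> ?T2)" by (rule arg_cong)
  moreover have "card (slack \<union> ?T1 \<union> ?T2) = card (slack \<union> ?T1) + card ?T2"
    using f1 f2 finite_slack by (intro card_Un_disjoint) (auto simp: slack_def)
  moreover have "card (slack \<union> ?T1) = card slack + card ?T1"
    using f1 finite_slack by (intro card_Un_disjoint) (auto simp: slack_def)
  ultimately have "card ?all = card slack + card ?T1 + card ?T2" by simp
  moreover have "own \<noteq> {} \<Longrightarrow> d \<le> n"
  proof -
    assume "own \<noteq> {}"
    then obtain X where "X \<in> F" using own_subset by auto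
    then show "d \<le> n" using memberD[of X] card_mono[OF finite_V, of X] by auto
  qed
  then have "card own * (n - d) + card own * d = n * card own"
    by (cases "own = {}") (auto simp flip: add_mult_distrib2)
  ultimately show ?thesis using all T1 T2 by simp
qed

definition unowned :: "'a set set" where "unowned = nsets V d - owned"

text \<open>
  Unless the slack is of larger order than \<open>n^d\<close>, almost every \<open>d\<close>-set is an own face.
\<close>
lemma card_unowned: "n * card unowned \<le> d * n ^ d + card slack"
proof -
  have fin: "finite (nsets V d)" using finite_V by (simp add: finite_imp_finite_nsets)
  have "card unowned + card own = n choose d"
    unfolding unowned_def using owned_subset fin card_mono[OF fin owned_subset]
    by (simp add: card_Diff_subset finite_subset flip: card_owned)
  then have "n * card unowned + n * card own = n * (n choose d)" by (metis distrib_left)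
  moreover have "n * (n choose d) \<le> (n - d) * (n choose d) + d * (n choose d)"
    by (simp flip: add_mult_distrib)
  moreover have "d * (n choose d) \<le> d * n ^ d" using choose_le_power by simp
  ultimately show ?thesis using slack_identity by linarith
qed

section \<open>Charging paired members to the slack\<close>

definition owner :: "'a set \<Rightarrow> 'a set" where "owner A = inv_into own own_face A"

definition chargeable :: "('a set \<times> 'a) set" where
  "chargeable = {(X, v). X \<in> paired \<and> v \<in> V - X \<and> insert v (core X) \<in> owned}"

text \<open>
  For \<open>X = B \<union> {p, q}\<close> with core \<open>B\<close> and own member \<open>B \<union> {v, p}\<close> this is \<open>(B \<union> {q}, v)\<close>.
\<close>
definition charge :: "'a set \<times> 'a \<Rightarrow> 'a set \<times> 'a" where
  "charge = (\<lambda>(X, v). (core X \<union> (X - owner (insert v (core X))), v))"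

lemma chargeE:
  assumes "(X, v) \<in> chargeable"
  obtains p q where "p \<noteq> q" and "p \<notin> core X" and "q \<notin> core X" and "X = insert p (insert q (core X))"
    and "insert p (insert v (core X)) \<in> own"
    and "own_face (insert p (insert v (core X))) = insert v (core X)"
    and "charge (X, v) = (insert q (core X), v)"
proof -
  let ?B = "core X"
  have X: "X \<in> paired" "v \<in> V" "v \<notin> X" and "insert v ?B \<in> owned"
    using assms by (auto simp: chargeable_def)
  then obtain Y where Y: "Y \<in> own" "own_face Y = insert v ?B" by (auto simp: owned_def)
  have ow: "owner (insert v ?B) = Y"
    unfolding owner_def using inv_into_f_f[OF inj_own_face Y(1)] Y(2) by simp
  have YF: "Y \<in> F" using Y own_subset by auto
  have sub: "insert v ?B \<subseteq> Y" using own_faceD(1)[OF Y(1)] Y(2) by auto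
  obtain p where p: "p \<in> X" "p \<in> Y" "p \<notin> ?B"
    using core_meets[OF pairedD(1)[OF X(1)] YF] sub by auto
  obtain p' q' where "X - ?B = {p', q'}" "p' \<noteq> q'" using pairedD(6)[OF X(1)] by (auto simp: card_2_iff)
  then obtain q where q: "X - ?B = {p, q}" "p \<noteq> q" using p by (metis Diff_iff doubleton_eq_iff insertE singletonD)
  have "insert p (insert v ?B) = Y"
  proof (rule card_seteq)
    have "v \<noteq> p" "v \<notin> ?B" using X p pairedD(5)[OF X(1)] by auto
    then show "card Y \<le> card (insert p (insert v ?B))"
      using memberD(3)[OF YF] pairedD(3,4)[OF X(1)] p by auto
  qed (use sub p memberD[OF YF] in auto)
  moreover have "X = insert p (insert q ?B)" using q pairedD(5)[OF X(1)] by auto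
  moreover have "X - Y = {q}"
    using calculation q X p by auto
  ultimately show thesis
    using that[of p q] q Y ow by (auto simp: charge_def)
qed

definition uncovered :: "'a set set" where
  "uncovered = {D \<in> nsets V d. \<forall>X\<in>F. \<not> D \<subseteq> X}"

lemma uncovered_subset: "uncovered \<subseteq> unowned"
proof -
  have "own_face X \<notin> uncovered" if "X \<in> own" for X
    using own_faceD(1)[OF that] that own_subset by (auto simp: uncovered_def)
  then have "D \<notin> owned" if "D \<in> uncovered" for D
    using that by (auto simp: owned_def)
  then show ?thesis by (auto simp: unowned_def uncovered_def)
qed

lemma finite_unowned: "finite unowned"
  unfolding unowned_def using finite_V by (simp add: finite_imp_finite_nsets)

text \<open>
  The \<open>d\<close>-set \<open>B \<union> {q}\<close> lies in \<open>X\<close>, which is not own, so it is no own face; and \<open>B \<union> {v, q}\<close> is not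
  own, since \<open>B \<union> {v}\<close> lies in no member but \<open>B \<union> {v, p}\<close>.
\<close>
lemma charge_in_slack:
  assumes "(X, v) \<in> chargeable"
  shows "charge (X, v) \<in> slack" and "fst (charge (X, v)) \<notin> uncovered"
proof -
  let ?B = "core X"
  obtain p q where pq: "p \<noteq> q" "p \<notin> ?B" "q \<notin> ?B" "X = insert p (insert q ?B)"
    "insert p (insert v ?B) \<in> own" "own_face (insert p (insert v ?B)) = insert v ?B"
    "charge (X, v) = (insert q ?B, v)" using chargeE[OF assms] .
  have X: "X \<in> paired" "v \<in> V" "v \<notin> X" using assms by (auto simp: chargeable_def)
  have XF: "X \<in> F" "X \<notin> own" using pairedD[OF X(1)] by auto
  have sub: "insert q ?B \<subseteq> X" using pq(4) by auto
  have "insert q ?B \<in> nsets V d"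
    using pairedD(3,4)[OF X(1)] pq(3) sub memberD[OF XF(1)] by (auto simp: nsets_def)
  moreover have "insert q ?B \<notin> owned"
  proof
    assume "insert q ?B \<in> owned"
    then obtain Y where "Y \<in> own" "insert q ?B = own_face Y" by (auto simp: owned_def)
    then show False using own_faceD(3)[of Y X] XF sub by auto
  qed
  moreover have "insert v (insert q ?B) \<notin> own"
  proof
    assume "insert v (insert q ?B) \<in> own"
    then have "insert v (insert q ?B) = insert p (insert v ?B)"
      using own_faceD(3)[OF pq(5), of "insert v (insert q ?B)"] pq(6) own_subset by auto
    then show False using pq X by auto
  qed
  moreover have "v \<notin> insert q ?B" using X sub by auto
  ultimately show "charge (X, v) \<in> slack" using X pq(7) by (simp add: slack_def)
  show "fst (charge (X, v)) \<notin> uncovered" using pq(7) sub XF by (auto simp: uncovered_def)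
qed

lemma finite_chargeable: "finite chargeable"
proof (rule finite_subset)
  show "chargeable \<subseteq> F \<times> V" by (auto simp: chargeable_def paired_def)
qed (simp add: finite_F finite_V)

lemma card_slack_ge: "card (charge ` chargeable) + (n - d) * card uncovered \<le> card slack"
proof -
  let ?N = "SIGMA D : uncovered. V - D"
  have fN: "finite uncovered" using uncovered_subset finite_unowned finite_subset by blast
  have "?N \<subseteq> slack"
  proof clarify
    fix D v assume D: "D \<in> uncovered" "v \<in> V" "v \<notin> D"
    then have "insert v D \<notin> own" using own_subset by (auto simp: uncovered_def)
    then show "(D, v) \<in> slack" using D uncovered_subset by (auto simp: slack_def unowned_def)
  qed
  moreover have "charge ` chargeable \<subseteq> slack" using charge_in_slack(1) by auto
  moreover have "charge s \<notin> ?N" if "s \<in> chargeable" for s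
    using that charge_in_slack(2)[of "fst s" "snd s"] by (cases "charge s") auto
  then have "charge ` chargeable \<inter> ?N = {}" by (metis (no_types, lifting) disjoint_iff imageE)
  moreover have "finite ?N" using fN finite_V by auto
  ultimately have "card (charge ` chargeable) + card ?N \<le> card slack"
    using finite_slack finite_chargeable card_mono[of slack "charge ` chargeable \<union> ?N"]
      card_Un_disjoint[of "charge ` chargeable" ?N] by simp
  moreover have "card ?N = card uncovered * (n - d)"
  proof -
    have "card ?N = (\<Sum>D\<in>uncovered. card (V - D))" using fN finite_V by (intro card_SigmaI) auto
    also have "\<dots> = (\<Sum>D\<in>uncovered. n - d)"
      using finite_V by (intro sum.cong) (auto simp: uncovered_def nsets_def card_Diff_subset)
    finally show ?thesis by simp
  qed
  ultimately show ?thesis by (simp add: mult.commute)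
qed

text \<open>
  A pair \<open>(X, v)\<close> that cannot be charged yields the unowned set \<open>D = core X \<union> {v}\<close>.  From \<open>D\<close> the point \<open>v\<close>
  is recovered up to \<open>d\<close> choices, the core up to \<open>2^d\<close> choices, and \<open>X\<close> from its core up to \<open>\<kappa>\<close> choices.
\<close>
lemma card_chargeable_ge:
  "n * card paired \<le> card chargeable + Suc d * card paired + 2 ^ d * \<kappa> * d * card unowned"
proof -
  let ?R = "{(X, v). X \<in> paired \<and> v \<in> V - X \<and> insert v (core X) \<in> unowned}"
  let ?A = "SIGMA X : paired. V - X"
  have fp: "finite paired" using finite_F by (simp add: paired_def)
  have "card ?A = (\<Sum>X\<in>paired. card (V - X))" using fp finite_V by (intro card_SigmaI) auto
  also have "\<dots> = (\<Sum>X\<in>paired. n - Suc d)"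
    using pairedD(1) memberD by (intro sum.cong) (auto simp: card_Diff_subset)
  finally have A: "card ?A = card paired * (n - Suc d)" by simp
  have "insert v (core X) \<in> nsets V d" if "X \<in> paired" "v \<in> V - X" for X v
    using that pairedD(3,4,5)[OF that(1)] memberD(1)[OF pairedD(1)[OF that(1)]]
    by (auto simp: nsets_def card_insert_if)
  then have "?A \<subseteq> chargeable \<union> ?R" by (auto simp: chargeable_def unowned_def)
  moreover have fR: "finite ?R" by (rule finite_subset[of _ ?A]) (use fp finite_V in auto)
  ultimately have "card ?A \<le> card chargeable + card ?R"
    using finite_chargeable card_mono[of "chargeable \<union> ?R" ?A] card_Un_le[of chargeable ?R] by simp
  moreover have "card ?R \<le> card unowned * (2 ^ d * \<kappa> * d)"
  proof -
    have "?R \<subseteq> (\<Union>D\<in>unowned. {X \<in> F. core X \<in> Pow D} \<times> D)"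
      using pairedD(1) by auto
    moreover have fin: "finite D" "card D = d" if "D \<in> unowned" for D
      using that by (auto simp: unowned_def nsets_def)
    ultimately have "card ?R \<le> card (\<Union>D\<in>unowned. {X \<in> F. core X \<in> Pow D} \<times> D)"
      using finite_unowned finite_F by (intro card_mono) auto
    also have "\<dots> \<le> card unowned * (2 ^ d * \<kappa> * d)"
    proof (rule card_UN_bounded[OF finite_unowned])
      fix D assume D: "D \<in> unowned"
      have "card {X \<in> F. core X \<in> Pow D} \<le> card (Pow D) * \<kappa>"
        using fin[OF D] by (intro card_le_cores) auto
      then show "card ({X \<in> F. core X \<in> Pow D} \<times> D) \<le> 2 ^ d * \<kappa> * d"
        using fin[OF D] by (simp add: card_cartesian_product card_Pow)
    qed
    finally show ?thesis .
  qed
  moreover have "n * card paired \<le> card paired * (n - Suc d) + Suc d * card paired"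
  proof -
    have "n \<le> (n - Suc d) + Suc d" by simp
    then have "n * card paired \<le> ((n - Suc d) + Suc d) * card paired" by (rule mult_right_mono) simp
    then show ?thesis by (simp only: add_mult_distrib mult.commute[of "card paired"])
  qed
  ultimately show ?thesis using A by (simp add: mult.commute)
qed

section \<open>Collisions of charges\<close>

text \<open>
  The paired member \<open>C \<union> {x, y, a}\<close> has core \<open>C \<union> {x}\<close>, so every member containing this core
  also contains \<open>y\<close> or \<open>a\<close>.
\<close>
definition fork :: "'a set \<Rightarrow> 'a \<Rightarrow> 'a \<Rightarrow> 'a \<Rightarrow> bool" where
  "fork C x y a \<longleftrightarrow> x \<notin> C \<and> y \<notin> insert x C \<and> a \<notin> insert x C \<and> y \<noteq> a \<and>
    insert y (insert a (insert x C)) \<in> paired \<and> core (insert y (insert a (insert x C))) = insert x C"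

definition clash :: "'a set \<Rightarrow> 'a \<Rightarrow> 'a \<Rightarrow> 'a \<Rightarrow> 'a \<Rightarrow> bool" where
  "clash C x x' a b \<longleftrightarrow> fork C x x' a \<and> fork C x' x b \<and> a \<noteq> b"

definition clashing :: "'a set \<Rightarrow> 'a set" where
  "clashing C = {x. \<exists>x' a b. clash C x x' a b}"

text \<open>
  Let \<open>D\<close> be the common \<open>d\<close>-set of the two charges.  Then \<open>X = D \<union> {p}\<close> and \<open>X' = D \<union> {p'}\<close>, while the cores
  arise from \<open>D\<close> by removing \<open>q\<close> and \<open>q'\<close>.  If \<open>q = q'\<close>, the two cores agree, and \<open>p\<close> and \<open>p'\<close> are both the
  point added to core and \<open>v\<close> in the same own member.  So \<open>q \<noteq> q'\<close>, and \<open>C = D - {q, q'}\<close>.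
\<close>
lemma collision_clash:
  assumes X: "(X, v) \<in> chargeable" and X': "(X', v) \<in> chargeable"
    and eq: "charge (X, v) = charge (X', v)" and ne: "X \<noteq> X'"
  obtains C x where "C \<subseteq> V" and "card C + 2 = d" and "x \<in> clashing C" and "core X = insert x C"
proof -
  obtain p q where pq: "p \<noteq> q" "p \<notin> core X" "q \<notin> core X" "X = insert p (insert q (core X))"
    "insert p (insert v (core X)) \<in> own" "own_face (insert p (insert v (core X))) = insert v (core X)"
    "charge (X, v) = (insert q (core X), v)" using chargeE[OF X] .
  obtain p' q' where pq': "p' \<noteq> q'" "p' \<notin> core X'" "q' \<notin> core X'" "X' = insert p' (insert q' (core X'))"
    "insert p' (insert v (core X')) \<in> own" "own_face (insert p' (insert v (core X'))) = insert v (core X')"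
    "charge (X', v) = (insert q' (core X'), v)" using chargeE[OF X'] .
  have P: "X \<in> paired" "X' \<in> paired" and v: "v \<notin> X" "v \<notin> X'"
    using X X' by (auto simp: chargeable_def)
  have D: "insert q (core X) = insert q' (core X')" using eq pq(7) pq'(7) by simp
  have pp: "p \<noteq> p'" using ne pq(4) pq'(4) D by auto
  have "q \<noteq> q'"
  proof
    assume "q = q'"
    then have "core X = core X'" using D pq(3) pq'(3) by (metis Diff_insert_absorb)
    then have "insert p (insert v (core X)) = insert p' (insert v (core X))"
      using inj_onD[OF inj_own_face, OF _ pq(5) pq'(5)] pq(6) pq'(6) by simp
    moreover have "p \<noteq> v" using v pq(4) by auto
    ultimately show False using pp pq(2) by auto
  qed
  define C where "C = core X - {q'}"
  have "q' \<in> core X" using D \<open>q \<noteq> q'\<close> by auto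
  then have q'C: "core X = insert q' C" by (auto simp: C_def)
  have "core X' = insert q (core X) - {q'}" using D pq'(3) by simp
  then have qC: "core X' = insert q C" using \<open>q \<noteq> q'\<close> by (auto simp: C_def)
  have nq: "q' \<notin> C" "q \<notin> C" using pq(3) by (auto simp: C_def)
  have "X = insert q (insert p (insert q' C))" using pq(4) q'C by auto
  then have "fork C q' q p"
    using pq(1-3) nq q'C P(1) \<open>q \<noteq> q'\<close> unfolding fork_def by auto
  moreover have "X' = insert q' (insert p' (insert q C))" using pq'(4) qC by auto
  then have "fork C q q' p'"
    using pq'(1-3) nq qC P(2) \<open>q \<noteq> q'\<close> unfolding fork_def by auto
  ultimately have "q' \<in> clashing C" using pp by (auto simp: clashing_def clash_def)
  moreover have "C \<subseteq> V" using q'C pairedD(1,5)[OF P(1)] memberD(1) by blast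
  moreover have "card C + 2 = d"
    using pairedD(3,4)[OF P(1)] q'C nq by simp
  ultimately show thesis using that q'C by blast
qed

text \<open>
  A member \<open>G\<close> containing \<open>C \<union> {x, z}\<close> has just one further point, and this point has to hit both pairs
  \<open>{y, a}\<close> and \<open>{w, e}\<close>.
\<close>
lemma fork_common_end:
  assumes f: "fork C x y a" "fork C z w e" and C: "card C + 2 = d"
    and G: "G \<in> F" "insert x (insert z C) \<subseteq> G"
    and ne: "x \<noteq> z" "z \<noteq> y" "z \<noteq> a" "x \<noteq> w" "x \<noteq> e"
  shows "\<exists>t. t \<in> {y, a} \<and> t \<in> {w, e}"
proof -
  let ?X = "insert y (insert a (insert x C))" and ?Z = "insert w (insert e (insert z C))"
  have X: "?X \<in> paired" "core ?X = insert x C" and Z: "?Z \<in> paired" "core ?Z = insert z C"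
    using f by (auto simp: fork_def)
  obtain s where s: "s \<in> ?X" "s \<in> G" "s \<notin> insert x C"
    using core_meets[OF pairedD(1)[OF X(1)] G(1)] X(2) G(2) by auto
  obtain t where t: "t \<in> ?Z" "t \<in> G" "t \<notin> insert z C"
    using core_meets[OF pairedD(1)[OF Z(1)] G(1)] Z(2) G(2) by auto
  have nz: "x \<notin> C" "z \<notin> C" using f by (auto simp: fork_def)
  have fin: "finite C" using pairedD(3)[OF X(1)] X(2) by auto
  have "card (G - insert x (insert z C)) = 1"
    using G memberD[OF G(1)] fin nz ne(1) C by (subst card_Diff_subset) auto
  then obtain g where g: "G - insert x (insert z C) = {g}" by (auto simp: card_1_singleton_iff)
  have "s \<in> {y, a}" "t \<in> {w, e}" using s t by auto
  moreover have "s = g" "t = g" using g s t ne calculation by auto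
  ultimately show ?thesis by auto
qed

text \<open>
  If both \<open>d\<close>-sets were covered, the pair \<open>{x', a}\<close> would share a point with \<open>{y', e}\<close> and one with
  \<open>{y, f}\<close>.  In general position only \<open>a = e\<close> and \<open>a = f\<close> remain, contrary to \<open>e \<noteq> f\<close>.
\<close>
lemma clash_uncovered:
  assumes x: "clash C x x' a b" and y: "clash C y y' e f" and C: "card C + 2 = d"
    and ne: "y \<notin> {x, x', a}" "y' \<notin> {x, x', a}" "x \<notin> {e, f}" "x' \<notin> {e, f}"
  shows "insert x (insert y C) \<in> uncovered \<or> insert x (insert y' C) \<in> uncovered"
proof (rule ccontr)
  assume neg: "\<not> ?thesis"
  have xf: "fork C x x' a" and yf: "fork C y y' e" "fork C y' y f" and ef: "e \<noteq> f"
    using x y by (auto simp: clash_def)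
  have in_nsets: "insert x (insert z C) \<in> nsets V d" if z: "fork C z w u" "x \<noteq> z" for z w u
  proof -
    have "insert x C \<subseteq> V" "finite C"
      using xf pairedD(1,3)[of "insert x' (insert a (insert x C))"] memberD(1)[of "insert x' (insert a (insert x C))"]
      by (auto simp: fork_def)
    moreover have "z \<in> V"
      using z pairedD(1)[of "insert w (insert u (insert z C))"] memberD(1)[of "insert w (insert u (insert z C))"]
      by (auto simp: fork_def)
    moreover have "x \<notin> C" "z \<notin> C" using xf z by (auto simp: fork_def)
    ultimately show ?thesis using z C by (auto simp: nsets_def)
  qed
  obtain G where G: "G \<in> F" "insert x (insert y C) \<subseteq> G"
    using neg in_nsets[OF yf(1)] ne(1) by (auto simp: uncovered_def)
  obtain H where H: "H \<in> F" "insert x (insert y' C) \<subseteq> H"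
    using neg in_nsets[OF yf(2)] ne(2) by (auto simp: uncovered_def)
  have "\<exists>t. t \<in> {x', a} \<and> t \<in> {y', e}"
    using fork_common_end[OF xf yf(1) C G] ne by auto
  then have "a = e" using ne by auto
  moreover have "\<exists>t. t \<in> {x', a} \<and> t \<in> {y, f}"
    using fork_common_end[OF xf yf(2) C H] ne by auto
  then have "a = f" using ne by auto
  ultimately show False using ef by simp
qed

definition \<mu> :: nat where "\<mu> = \<kappa> * Suc d"

text \<open>
  A set of bounded size containing every point \<open>x\<close> that clashes with \<open>q\<close>; it bounds the number of points
  with the same partner.
\<close>
definition ends :: "'a set \<Rightarrow> 'a \<Rightarrow> 'a set" where
  "ends C q = (\<Union>X\<in>{X \<in> F. core X = insert q C}. X)"

lemma card_ends: "card (ends C q) \<le> \<mu>"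
proof -
  have "card (ends C q) \<le> card {X \<in> F. core X = insert q C} * Suc d"
    unfolding ends_def using finite_F memberD(3) by (intro card_UN_bounded) auto
  also have "\<dots> \<le> \<mu>" unfolding \<mu>_def using card_same_core by (intro mult_right_mono) auto
  finally show ?thesis .
qed

lemma finite_ends: "finite (ends C q)"
  unfolding ends_def using finite_F memberD(2) by auto

lemma clash_mem_ends: "clash C x x' a b \<Longrightarrow> x \<in> ends C x'"
  using pairedD(1) by (force simp: clash_def fork_def ends_def)

lemma clashing_subset: "clashing C \<subseteq> V"
proof
  fix x assume "x \<in> clashing C"
  then obtain x' a b where "insert x' (insert a (insert x C)) \<in> paired"
    by (auto simp: clashing_def clash_def fork_def)
  then show "x \<in> V" using pairedD(1) memberD(1) by blast
qed

text \<open>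
  Fix one clash for every clashing point.  The sets \<open>?S1\<close>, \<open>?S2\<close> and \<open>?S3\<close> in the proof collect the pairs
  \<open>(x, y)\<close> in special position, linearly many in the number of clashing points.  Each remaining pair
  gives an uncovered superset of \<open>C\<close>, and each such superset arises from boundedly many pairs.
\<close>
lemma clashing_square:
  assumes C: "card C + 2 = d"
  shows "card (clashing C) ^ 2
    \<le> card (clashing C) * (5 + 5 * \<mu>) + card {D \<in> uncovered. C \<subseteq> D} * (d * (d + d * \<mu>))"
proof -
  let ?T = "clashing C"
  have fT: "finite ?T" using clashing_subset finite_V finite_subset by blast
  have "\<forall>x\<in>?T. \<exists>w. clash C x (fst w) (fst (snd w)) (snd (snd w))"
    by (auto simp: clashing_def)
  then obtain w where w: "\<And>x. x \<in> ?T \<Longrightarrow> clash C x (fst (w x)) (fst (snd (w x))) (snd (snd (w x)))"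
    by (metis bchoice)
  define r a b where "r = (\<lambda>x. fst (w x))" and "a = (\<lambda>x. fst (snd (w x)))" and "b = (\<lambda>x. snd (snd (w x)))"
  have cl: "clash C x (r x) (a x) (b x)" if "x \<in> ?T" for x
    using w[OF that] by (simp add: r_def a_def b_def)
  have re: "x \<in> ends C (r x)" if "x \<in> ?T" for x using clash_mem_ends[OF cl[OF that]] .
  \<comment> \<open>\<open>y\<close> equals \<open>x\<close> or an end of the clash of \<open>x\<close>\<close>
  let ?S1 = "SIGMA x : ?T. {x, r x, a x}"
  \<comment> \<open>contains \<open>(x, y)\<close> if the partner of \<open>y\<close> is \<open>x\<close> or an end of the clash of \<open>x\<close>\<close>
  let ?S2 = "SIGMA x : ?T. ends C x \<union> ends C (r x) \<union> ends C (a x)"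
  \<comment> \<open>contains \<open>(y, x)\<close> if \<open>x\<close> or the partner of \<open>x\<close> is one of the points \<open>a y\<close> and \<open>b y\<close>\<close>
  let ?S3 = "SIGMA y : ?T. {a y, b y} \<union> ends C (a y) \<union> ends C (b y)"
  \<comment> \<open>contains \<open>(x, y)\<close> if \<open>x\<close> with \<open>y\<close> or with the partner of \<open>y\<close> completes \<open>C\<close> to an uncovered set\<close>
  let ?S4 = "\<Union>D\<in>{D \<in> uncovered. C \<subseteq> D}. (D - C) \<times> ((D - C) \<union> (\<Union>q\<in>D - C. ends C q))"
  have fS: "finite ?S1" "finite ?S2" "finite ?S3" using fT finite_ends by auto
  have unc: "finite D" "card D = d" if "D \<in> uncovered" for D
    using that by (auto simp: uncovered_def nsets_def)
  have fU: "finite {D \<in> uncovered. C \<subseteq> D}"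
    using uncovered_subset finite_unowned by (auto intro: finite_subset)
  have fS4: "finite ?S4" using fU unc finite_ends by auto
  have "(x, y) \<in> ?S1 \<union> ?S2 \<union> prod.swap ` ?S3 \<union> ?S4" if x: "x \<in> ?T" and y: "y \<in> ?T" for x y
  proof (rule ccontr)
    assume "\<not> ?thesis"
    then have n1: "(x, y) \<notin> ?S1" and n2: "(x, y) \<notin> ?S2" and n3: "(x, y) \<notin> prod.swap ` ?S3"
      and n4: "(x, y) \<notin> ?S4" by (simp_all only: Un_iff de_Morgan_disj simp_thms)
    have "(y, x) \<notin> ?S3"
    proof
      assume "(y, x) \<in> ?S3"
      then have "prod.swap (y, x) \<in> prod.swap ` ?S3" by (rule imageI)
      with n3 show False by (simp only: swap_simp simp_thms)
    qed
    then have n3': "x \<notin> {a y, b y}" "x \<notin> ends C (a y)" "x \<notin> ends C (b y)" using y by auto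
    have "y \<notin> {x, r x, a x}" using n1 x by auto
    moreover have "r y \<notin> {x, r x, a x}" using n2 x re[OF y] by auto
    moreover have "r x \<notin> {a y, b y}" using n3' re[OF x] by auto
    ultimately have "insert x (insert y C) \<in> uncovered \<or> insert x (insert (r y) C) \<in> uncovered"
      using n3' by (intro clash_uncovered[OF cl[OF x] cl[OF y] C]) auto
    moreover have "x \<notin> C" "y \<notin> C" "r y \<notin> C"
      using cl[OF x] cl[OF y] by (auto simp: clash_def fork_def)
    ultimately have "(x, y) \<in> ?S4"
    proof (elim disjE)
      assume "insert x (insert y C) \<in> uncovered"
      then show ?thesis using \<open>x \<notin> C\<close> \<open>y \<notin> C\<close> by (intro UN_I[of "insert x (insert y C)"]) auto
    next
      assume "insert x (insert (r y) C) \<in> uncovered"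
      then show ?thesis using \<open>x \<notin> C\<close> \<open>r y \<notin> C\<close> re[OF y]
        by (intro UN_I[of "insert x (insert (r y) C)"]) auto
    qed
    then show False using n4 by contradiction
  qed
  then have "?T \<times> ?T \<subseteq> ?S1 \<union> ?S2 \<union> prod.swap ` ?S3 \<union> ?S4" by (intro subsetI) (elim SigmaE, simp only:)
  then have "card (?T \<times> ?T) \<le> card (?S1 \<union> ?S2 \<union> prod.swap ` ?S3 \<union> ?S4)"
    using fS fS4 by (intro card_mono) (simp_all only: finite_Un finite_imageI simp_thms)
  also have "\<dots> \<le> card ?S1 + card ?S2 + card ?S3 + card ?S4"
    using card_Un_le[of "?S1 \<union> ?S2 \<union> prod.swap ` ?S3" ?S4] card_Un_le[of "?S1 \<union> ?S2" "prod.swap ` ?S3"]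
      card_Un_le[of ?S1 ?S2] card_image_le[OF fS(3), of prod.swap] by linarith
  finally have "card (?T \<times> ?T) \<le> card ?S1 + card ?S2 + card ?S3 + card ?S4" .
  moreover have "card ?S1 \<le> card ?T * 3"
  proof -
    have "card ?S1 = (\<Sum>x\<in>?T. card {x, r x, a x})" using fT by (intro card_SigmaI) auto
    also have "\<dots> \<le> card ?T * 3"
      using sum_bounded_above[of ?T "\<lambda>x. card {x, r x, a x}" 3] by (simp add: card_insert_if)
    finally show ?thesis .
  qed
  moreover have "card ?S2 \<le> card ?T * (3 * \<mu>)"
  proof -
    have "card (ends C x \<union> ends C (r x) \<union> ends C (a x)) \<le> 3 * \<mu>" for x
      using card_Un_le[of "ends C x \<union> ends C (r x)" "ends C (a x)"] card_Un_le[of "ends C x" "ends C (r x)"]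
        card_ends[of C x] card_ends[of C "r x"] card_ends[of C "a x"] by linarith
    then have "(\<Sum>x\<in>?T. card (ends C x \<union> ends C (r x) \<union> ends C (a x))) \<le> card ?T * (3 * \<mu>)"
      using sum_bounded_above[of ?T "\<lambda>x. card (ends C x \<union> ends C (r x) \<union> ends C (a x))" "3 * \<mu>"] by simp
    moreover have "card ?S2 = (\<Sum>x\<in>?T. card (ends C x \<union> ends C (r x) \<union> ends C (a x)))"
      using fT finite_ends by (intro card_SigmaI) auto
    ultimately show ?thesis by simp
  qed
  moreover have "card ?S3 \<le> card ?T * (2 + 2 * \<mu>)"
  proof -
    have "card ({a y, b y} \<union> ends C (a y) \<union> ends C (b y)) \<le> 2 + 2 * \<mu>" for y
      using card_Un_le[of "{a y, b y} \<union> ends C (a y)" "ends C (b y)"] card_Un_le[of "{a y, b y}" "ends C (a y)"]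
        card_ends[of C "a y"] card_ends[of C "b y"] card_insert_le_m1[of 2 "{b y}" "a y"] by simp
    then have "(\<Sum>y\<in>?T. card ({a y, b y} \<union> ends C (a y) \<union> ends C (b y))) \<le> card ?T * (2 + 2 * \<mu>)"
      using sum_bounded_above[of ?T "\<lambda>y. card ({a y, b y} \<union> ends C (a y) \<union> ends C (b y))" "2 + 2 * \<mu>"] by simp
    moreover have "card ?S3 = (\<Sum>y\<in>?T. card ({a y, b y} \<union> ends C (a y) \<union> ends C (b y)))"
      using fT finite_ends by (intro card_SigmaI) auto
    ultimately show ?thesis by simp
  qed
  moreover have "card ?S4 \<le> card {D \<in> uncovered. C \<subseteq> D} * (d * (d + d * \<mu>))"
  proof (rule card_UN_bounded[OF fU])
    fix D assume "D \<in> {D \<in> uncovered. C \<subseteq> D}"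
    then have D: "finite D" "card D = d" using unc by auto
    then have dc: "card (D - C) \<le> d" using card_mono[of D "D - C"] by auto
    have "card (\<Union>q\<in>D - C. ends C q) \<le> card (D - C) * \<mu>"
      using D card_ends by (intro card_UN_bounded) auto
    also have "\<dots> \<le> d * \<mu>" using dc by simp
    finally have "card ((D - C) \<union> (\<Union>q\<in>D - C. ends C q)) \<le> d + d * \<mu>"
      using card_Un_le[of "D - C" "\<Union>q\<in>D - C. ends C q"] dc by linarith
    then show "card ((D - C) \<times> ((D - C) \<union> (\<Union>q\<in>D - C. ends C q))) \<le> d * (d + d * \<mu>)"
      using dc by (simp only: card_cartesian_product mult_le_mono)
  qed
  ultimately have "card ?T * card ?T \<le> card ?T * 3 + card ?T * (3 * \<mu>) + card ?T * (2 + 2 * \<mu>)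
      + card {D \<in> uncovered. C \<subseteq> D} * (d * (d + d * \<mu>))"
    unfolding card_cartesian_product by linarith
  then show ?thesis by (simp add: power2_eq_square algebra_simps)
qed

section \<open>The upper bound\<close>

text \<open>
  If the number \<open>t\<close> of clashing points exceeds \<open>\<nu>\<close>, the linear term in \<open>clashing_square\<close> is absorbed and
  the uncovered sets outnumber \<open>t\<close> by the factor \<open>2^d \<kappa>\<close>.
\<close>
definition \<nu> :: nat where "\<nu> = 5 + 5 * \<mu> + 2 ^ d * \<kappa> * (d * (d + d * \<mu>))"

lemma card_clashing:
  assumes "card C + 2 = d"
  shows "2 ^ d * \<kappa> * card (clashing C) \<le> card {D \<in> uncovered. C \<subseteq> D} + 2 ^ d * \<kappa> * \<nu>"
proof (cases "card (clashing C) \<le> \<nu>")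
  case True
  then show ?thesis by (simp add: trans_le_add2)
next
  case False
  let ?t = "card (clashing C)" and ?N = "card {D \<in> uncovered. C \<subseteq> D}" and ?k = "d * (d + d * \<mu>)"
  have k: "0 < ?k" using d_pos by simp
  have "?t * (5 + 5 * \<mu>) + ?t * (2 ^ d * \<kappa> * ?k) = ?t * \<nu>" by (simp add: \<nu>_def algebra_simps)
  also have "\<dots> \<le> ?t * ?t" using False by simp
  also have "\<dots> \<le> ?t * (5 + 5 * \<mu>) + ?N * ?k"
    using clashing_square[OF assms] by (simp add: power2_eq_square)
  finally have "(2 ^ d * \<kappa> * ?t) * ?k \<le> ?N * ?k" by (simp add: algebra_simps)
  then have "2 ^ d * \<kappa> * ?t \<le> ?N" using k by (simp only: mult_le_cancel2)
  then show ?thesis by simp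
qed

definition colliding :: "('a set \<times> 'a) set" where
  "colliding = {s \<in> chargeable. \<exists>t\<in>chargeable. t \<noteq> s \<and> charge t = charge s}"

text \<open>
  Sum \<open>card_clashing\<close> over all \<open>C\<close> of size \<open>d - 2\<close>.  An uncovered \<open>d\<close>-set contains at most \<open>2^d\<close> such \<open>C\<close>,
  which the factor \<open>2^d\<close> in \<open>card_clashing\<close> compensates, so that uncovered sets enter with coefficient
  exactly \<open>n\<close>: this is what their \<open>n - d\<close> slack pairs can pay for, up to an error of order \<open>n^(d-1)\<close>.
\<close>
lemma card_colliding: "card colliding \<le> n * card uncovered + d * \<kappa> * \<nu> * n ^ (d - 1)"
proof -
  let ?L = "{C. C \<subseteq> V \<and> card C + 2 = d}"
  let ?low = "{C. C \<subseteq> V \<and> card C + 2 \<le> d}"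
  let ?X = "\<lambda>C. {X \<in> F. core X \<in> (\<lambda>x. insert x C) ` clashing C}"
  have fL: "finite ?L" using finite_V by (intro finite_subset[of ?L "Pow V"]) auto
  have fU: "finite uncovered" using uncovered_subset finite_unowned finite_subset by blast
  have "colliding \<subseteq> (\<Union>C\<in>?L. ?X C) \<times> V"
  proof
    fix s assume s: "s \<in> colliding"
    obtain X v where Xv: "s = (X, v)" by (cases s)
    from s obtain t where t: "t \<in> chargeable" "t \<noteq> s" "charge t = charge s"
      and s': "(X, v) \<in> chargeable" unfolding colliding_def Xv by blast
    obtain X' v' where Xv': "t = (X', v')" by (cases t)
    have v: "v' = v" using t(3) unfolding Xv Xv' by (simp add: charge_def)
    have "X \<noteq> X'" using t(2) v unfolding Xv Xv' by simp
    moreover have "(X', v) \<in> chargeable" "charge (X, v) = charge (X', v)"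
      using t v unfolding Xv Xv' by simp_all
    ultimately obtain C x where "C \<subseteq> V" "card C + 2 = d" "x \<in> clashing C" "core X = insert x C"
      using collision_clash[OF s'] by metis
    moreover have "X \<in> F" "v \<in> V" using s' by (auto simp: chargeable_def paired_def)
    ultimately show "s \<in> (\<Union>C\<in>?L. ?X C) \<times> V" unfolding Xv by blast
  qed
  then have "card colliding \<le> card ((\<Union>C\<in>?L. ?X C) \<times> V)"
    using fL finite_F finite_V by (intro card_mono) auto
  then have c1: "card colliding \<le> card (\<Union>C\<in>?L. ?X C) * n" by (simp add: card_cartesian_product)
  have "card (\<Union>C\<in>?L. ?X C) \<le> (\<Sum>C\<in>?L. card (?X C))" by (rule card_UN_le[OF fL])
  also have "\<dots> \<le> (\<Sum>C\<in>?L. \<kappa> * card (clashing C))"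
  proof (rule sum_mono)
    fix C
    have fc: "finite (clashing C)" using clashing_subset finite_V finite_subset by blast
    then have "card (?X C) \<le> card ((\<lambda>x. insert x C) ` clashing C) * \<kappa>"
      by (intro card_le_cores) auto
    also have "\<dots> \<le> card (clashing C) * \<kappa>" using fc by (intro mult_right_mono card_image_le) auto
    finally show "card (?X C) \<le> \<kappa> * card (clashing C)" by (simp add: mult.commute)
  qed
  finally have c2: "card (\<Union>C\<in>?L. ?X C) \<le> (\<Sum>C\<in>?L. \<kappa> * card (clashing C))" .
  have "2 ^ d * (\<Sum>C\<in>?L. \<kappa> * card (clashing C)) = (\<Sum>C\<in>?L. 2 ^ d * \<kappa> * card (clashing C))"
    by (simp add: sum_distrib_left mult.assoc)
  also have "\<dots> \<le> (\<Sum>C\<in>?L. card {D \<in> uncovered. C \<subseteq> D} + 2 ^ d * \<kappa> * \<nu>)"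
    using card_clashing by (intro sum_mono) simp
  also have "\<dots> = (\<Sum>C\<in>?L. card {D \<in> uncovered. C \<subseteq> D}) + card ?L * (2 ^ d * \<kappa> * \<nu>)"
    by (simp add: sum.distrib)
  also have "(\<Sum>C\<in>?L. card {D \<in> uncovered. C \<subseteq> D}) = (\<Sum>D\<in>uncovered. card {C \<in> ?L. C \<subseteq> D})"
    by (rule sum_multicount_gen[OF fL fU]) simp
  finally have "2 ^ d * (\<Sum>C\<in>?L. \<kappa> * card (clashing C))
      \<le> (\<Sum>D\<in>uncovered. card {C \<in> ?L. C \<subseteq> D}) + card ?L * (2 ^ d * \<kappa> * \<nu>)" .
  moreover have "(\<Sum>D\<in>uncovered. card {C \<in> ?L. C \<subseteq> D}) \<le> (\<Sum>D\<in>uncovered. 2 ^ d)"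
  proof (rule sum_mono)
    fix D assume "D \<in> uncovered"
    then have D: "finite D" "card D = d" by (auto simp: uncovered_def nsets_def)
    have "card {C \<in> ?L. C \<subseteq> D} \<le> card (Pow D)" using D by (intro card_mono) auto
    then show "card {C \<in> ?L. C \<subseteq> D} \<le> 2 ^ d" using D by (simp add: card_Pow)
  qed
  ultimately have "2 ^ d * (\<Sum>C\<in>?L. \<kappa> * card (clashing C)) \<le> 2 ^ d * (card uncovered + card ?L * (\<kappa> * \<nu>))"
    by (simp add: algebra_simps)
  then have "(\<Sum>C\<in>?L. \<kappa> * card (clashing C)) \<le> card uncovered + card ?L * (\<kappa> * \<nu>)" by simp
  with c2 have "card (\<Union>C\<in>?L. ?X C) \<le> card uncovered + card ?L * (\<kappa> * \<nu>)" by (rule le_trans)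
  then have "card (\<Union>C\<in>?L. ?X C) * n \<le> (card uncovered + card ?L * (\<kappa> * \<nu>)) * n" by (rule mult_right_mono) simp
  also have "\<dots> = n * card uncovered + (n * card ?L) * (\<kappa> * \<nu>)" by (simp add: algebra_simps)
  also have "\<dots> \<le> n * card uncovered + (d * n ^ (d - 1)) * (\<kappa> * \<nu>)"
  proof -
    have "card ?L \<le> card ?low" using finite_V by (intro card_mono finite_subset[of ?low "Pow V"]) auto
    then have "n * card ?L \<le> n * card ?low" by simp
    then have "n * card ?L \<le> d * n ^ (d - 1)" using card_low by (rule le_trans)
    then show ?thesis by (intro add_left_mono mult_right_mono) auto
  qed
  finally show ?thesis using c1 by (simp add: algebra_simps)
qed

definition unowned_factor :: nat where "unowned_factor = d + 2 ^ d * \<kappa> * d"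

lemma card_paired_le_slack:
  "n * card paired \<le> card slack + unowned_factor * card unowned + (d * \<kappa> * \<nu> + Suc d * \<kappa>) * n ^ (d - 1)"
proof -
  have "card chargeable \<le> card (charge ` chargeable) + card colliding"
    unfolding colliding_def using finite_chargeable by (rule card_le_image_plus_collisions)
  then have 1: "card chargeable \<le> card (charge ` chargeable) + n * card uncovered + d * \<kappa> * \<nu> * n ^ (d - 1)"
    using card_colliding by linarith
  have 2: "n * card uncovered \<le> (n - d) * card uncovered + d * card uncovered"
  proof -
    have "n * card uncovered \<le> ((n - d) + d) * card uncovered" by (rule mult_right_mono) simp_all
    then show ?thesis by (simp only: add_mult_distrib)
  qed
  have 3: "d * card uncovered \<le> d * card unowned"
    using uncovered_subset finite_unowned by (intro mult_left_mono card_mono) auto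
  have 4: "Suc d * card paired \<le> Suc d * \<kappa> * n ^ (d - 1)"
    using mult_left_mono[OF card_paired, of "Suc d"] by (simp only: mult.assoc zero_le)
  have "n * card paired \<le> card slack + (d * card unowned + 2 ^ d * \<kappa> * d * card unowned)
      + (d * \<kappa> * \<nu> * n ^ (d - 1) + Suc d * \<kappa> * n ^ (d - 1))"
    using 1 2 3 4 card_slack_ge card_chargeable_ge by linarith
  then show ?thesis by (simp only: unowned_factor_def add_mult_distrib)
qed

definition error_factor :: nat where
  "error_factor = d * \<kappa> + (unowned_factor * (d + \<kappa>) + (d * \<kappa> * \<nu> + Suc d * \<kappa>))"

lemma card_upper_bound:
  assumes "n \<ge> 1"
  shows "n * card F \<le> n * ((n - 1) choose d)
    + error_factor * n ^ (d - 1)"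
proof -
  let ?E = "unowned_factor * (d + \<kappa>) + (d * \<kappa> * \<nu> + Suc d * \<kappa>)"
  have P: "n * card paired \<le> card slack + ?E * n ^ (d - 1)"
  proof (cases "n * card paired \<le> card slack")
    case False
    \<comment> \<open>The slack is of order \<open>n^d\<close>, so only \<open>O(n^(d-1))\<close> sets are unowned.\<close>
    have nd: "n ^ d = n * n ^ (d - 1)" using d_pos by (simp flip: power_Suc)
    have "n * card paired \<le> n * (\<kappa> * n ^ (d - 1))" using card_paired by (rule mult_left_mono) simp
    also have "\<dots> = \<kappa> * n ^ d" unfolding nd by (rule mult.left_commute)
    finally have "card slack \<le> \<kappa> * n ^ d" using False by linarith
    then have "n * card unowned \<le> n * ((d + \<kappa>) * n ^ (d - 1))"
      using card_unowned nd by (simp add: algebra_simps)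
    then have "card unowned \<le> (d + \<kappa>) * n ^ (d - 1)" using assms by simp
    then have "unowned_factor * card unowned \<le> unowned_factor * ((d + \<kappa>) * n ^ (d - 1))"
      by (rule mult_left_mono) simp
    then show ?thesis using card_paired_le_slack by (simp add: algebra_simps)
  qed simp
  have "n * card F = n * card own + n * card paired + n * card small_core"
    unfolding F_decomposition by (simp only: add_mult_distrib2)
  also have "\<dots> \<le> (card slack + n * card own) + (?E * n ^ (d - 1) + d * \<kappa> * n ^ (d - 1))"
    using P card_small_core by linarith
  also have "card slack + n * card own = n * ((n - 1) choose d)"
    unfolding slack_identity by (rule binomial_absorb_comp)
  finally show ?thesis by (simp only: error_factor_def add_mult_distrib add.commute add.left_commute)
qed

end

section \<open>Families attaining the lower bound\<close>

text \<open>
  A shattered set lies in a member, so one with more than \<open>d\<close> points would be a member itself.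
\<close>
lemma vc_dim_uniform_le_iff:
  assumes "F \<subseteq> nsets {1..n} (d + 1)"
  shows "vc_dim n F \<le> d \<longleftrightarrow> (\<forall>X\<in>F. \<exists>B\<subset>X. \<forall>Y\<in>F. Y \<inter> X \<noteq> B)"
proof
  assume vc: "vc_dim n F \<le> d"
  show "\<forall>X\<in>F. \<exists>B\<subset>X. \<forall>Y\<in>F. Y \<inter> X \<noteq> B"
  proof
    fix X assume X: "X \<in> F"
    then have "X \<subseteq> {1..n}" "card X = d + 1" using assms by (auto simp: nsets_def)
    then have "\<not> shatters F X" using vc[unfolded vc_dim_le_iff, rule_format, of X] by linarith
    then obtain B where B: "B \<subseteq> X" "\<forall>Y\<in>F. Y \<inter> X \<noteq> B" by (auto simp: shatters_def)
    moreover have "B \<noteq> X" using bspec[OF B(2) X] by auto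
    ultimately show "\<exists>B\<subset>X. \<forall>Y\<in>F. Y \<inter> X \<noteq> B" by blast
  qed
next
  assume miss: "\<forall>X\<in>F. \<exists>B\<subset>X. \<forall>Y\<in>F. Y \<inter> X \<noteq> B"
  show "vc_dim n F \<le> d" unfolding vc_dim_le_iff
  proof (intro allI impI)
    fix S assume S: "S \<subseteq> {1..n}" "shatters F S"
    then obtain X where X: "X \<in> F" "X \<inter> S = S" by (auto simp: shatters_def)
    then have XF: "finite X" "card X = d + 1" and "S \<subseteq> X" using assms by (auto simp: nsets_def)
    from bspec[OF miss X(1)] obtain B where B: "B \<subset> X" "\<forall>Y\<in>F. Y \<inter> X \<noteq> B" by (elim exE conjE)
    have "S \<noteq> X"
    proof
      assume "S = X"
      then have "\<exists>Y\<in>F. Y \<inter> X = B" using S(2) B(1) by (simp add: shatters_def)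
      then show False using B(2) by (elim bexE) simp
    qed
    then have "card S < card X" using XF \<open>S \<subseteq> X\<close> by (intro psubset_card_mono) auto
    then show "card S \<le> d" using XF by simp
  qed
qed

definition with_trace :: "nat \<Rightarrow> nat \<Rightarrow> nat set \<Rightarrow> nat set set" where
  "with_trace n k T = {X \<in> nsets {1..n} k. X \<inter> {1..4} = T}"

lemma with_trace_mem:
  assumes "X \<in> with_trace n k T" and "v \<in> {1..4}"
  shows "v \<in> X \<longleftrightarrow> v \<in> T"
  using assms by (auto simp: with_trace_def)

lemma card_with_trace:
  assumes "T \<subseteq> {1..4}" and "n \<ge> 4" and "card T \<le> k"
  shows "card (with_trace n k T) = (n - 4) choose (k - card T)"
proof -
  have fT: "finite T" using assms finite_subset by blast
  have "bij_betw (\<lambda>R. R \<union> T) (nsets {5..n} (k - card T)) (with_trace n k T)"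
  proof (rule bij_betw_byWitness[where f' = "\<lambda>X. X - T"])
    have dis: "R \<inter> T = {}" if "R \<in> nsets {5..n} (k - card T)" for R
      using that assms(1) by (fastforce simp: nsets_def)
    show "\<forall>R\<in>nsets {5..n} (k - card T). R \<union> T - T = R" using dis by blast
    show "\<forall>X\<in>with_trace n k T. X - T \<union> T = X" by (auto simp: with_trace_def)
    show "(\<lambda>R. R \<union> T) ` nsets {5..n} (k - card T) \<subseteq> with_trace n k T"
    proof
      fix X assume "X \<in> (\<lambda>R. R \<union> T) ` nsets {5..n} (k - card T)"
      then obtain R where R: "R \<in> nsets {5..n} (k - card T)" "X = R \<union> T" by blast
      have "card X = k" using R dis[OF R(1)] fT assms(3) by (simp add: nsets_def card_Un_disjoint)
      moreover have "X \<subseteq> {1..n}" using R assms by (fastforce simp: nsets_def)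
      moreover have "X \<inter> {1..4} = T" using R assms(1) by (fastforce simp: nsets_def)
      ultimately show "X \<in> with_trace n k T"
        using R fT by (simp add: with_trace_def nsets_def)
    qed
    show "(\<lambda>X. X - T) ` with_trace n k T \<subseteq> nsets {5..n} (k - card T)"
    proof
      fix R assume "R \<in> (\<lambda>X. X - T) ` with_trace n k T"
      then obtain X where X: "X \<in> nsets {1..n} k" "X \<inter> {1..4} = T" "R = X - T"
        by (auto simp: with_trace_def)
      have "R \<subseteq> {5..n}"
      proof
        fix v assume "v \<in> R"
        then have "v \<in> {1..n}" "v \<notin> {1..4}" using X by (auto simp: nsets_def)
        then show "v \<in> {5..n}" by auto
      qed
      moreover have "T \<subseteq> X" "finite X" "card X = k" using X(1,2) by (auto simp: nsets_def)
      ultimately show "R \<in> nsets {5..n} (k - card T)" using X(3) fT by (simp add: nsets_def card_Diff_subset)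
    qed
  qed
  then show ?thesis by (simp flip: bij_betw_same_card)
qed

definition star :: "nat \<Rightarrow> nat \<Rightarrow> nat set set" where
  "star n k = {X \<in> nsets {1..n} k. 1 \<in> X}"

lemma card_star:
  assumes "n \<ge> 1"
  shows "card (star n (Suc d)) = (n - 1) choose d"
proof -
  have "bij_betw (insert 1) (nsets {2..n} d) (star n (Suc d))"
  proof (rule bij_betw_byWitness[where f' = "\<lambda>X. X - {1}"])
    show "\<forall>R\<in>nsets {2..n} d. insert 1 R - {1} = R" by (fastforce simp: nsets_def)
    show "\<forall>X\<in>star n (Suc d). insert 1 (X - {1}) = X" by (auto simp: star_def)
    show "insert 1 ` nsets {2..n} d \<subseteq> star n (Suc d)"
    proof
      fix X assume "X \<in> insert 1 ` nsets {2..n} d"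
      then obtain R where R: "R \<subseteq> {2..n}" "finite R" "card R = d" "X = insert 1 R" by (auto simp: nsets_def)
      then have "1 \<notin> R" by auto
      then show "X \<in> star n (Suc d)" using R assms by (auto simp: star_def nsets_def)
    qed
    show "(\<lambda>X. X - {1}) ` star n (Suc d) \<subseteq> nsets {2..n} d"
    proof
      fix R assume "R \<in> (\<lambda>X. X - {1}) ` star n (Suc d)"
      then obtain X where X: "X \<subseteq> {1..n}" "finite X" "card X = Suc d" "1 \<in> X" "R = X - {1}"
        by (auto simp: star_def nsets_def)
      have "R \<subseteq> {2..n}"
      proof
        fix v assume "v \<in> R"
        then have "v \<in> {1..n}" "v \<noteq> 1" using X by auto
        then show "v \<in> {2..n}" by auto
      qed
      then show "R \<in> nsets {2..n} d" using X by (simp add: nsets_def)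
    qed
  qed
  then show ?thesis by (simp flip: bij_betw_same_card)
qed

lemma star_unshattered:
  assumes "X \<in> star n k"
  shows "\<exists>B\<subset>X. \<forall>Y\<in>star n k. Y \<inter> X \<noteq> B"
  using assms by (intro exI[of _ "X - {1}"]) (auto simp: star_def)

text \<open>
  In the star through \<open>1\<close>, the sets with trace \<open>{1, 4}\<close> on \<open>{1..4}\<close> are exchanged for equally many sets
  with trace \<open>{3, 4}\<close>.  This makes room for all sets with trace \<open>{2, 3, 4}\<close>.
\<close>
definition ahlswede_khachatrian :: "nat \<Rightarrow> nat \<Rightarrow> nat set set" where
  "ahlswede_khachatrian n k =
    (star n k - with_trace n k {1, 4}) \<union> with_trace n k {3, 4} \<union> with_trace n k {2, 3, 4}"

lemma ahlswede_khachatrian_trace: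
  assumes "Y \<in> ahlswede_khachatrian n k"
  shows "1 \<in> Y \<Longrightarrow> 4 \<in> Y \<Longrightarrow> 2 \<in> Y \<or> 3 \<in> Y" and "1 \<notin> Y \<Longrightarrow> 3 \<in> Y \<and> 4 \<in> Y"
    and "finite Y" and "card Y = k" and "Y \<subseteq> {1..n}"
proof -
  have sub: "{1..4} = {1, 2, 3, 4 :: nat}" by auto
  show "1 \<in> Y \<Longrightarrow> 4 \<in> Y \<Longrightarrow> 2 \<in> Y \<or> 3 \<in> Y"
    using assms unfolding ahlswede_khachatrian_def with_trace_def star_def sub by blast
  show "1 \<notin> Y \<Longrightarrow> 3 \<in> Y \<and> 4 \<in> Y"
    using assms unfolding ahlswede_khachatrian_def with_trace_def star_def by blast
  show "finite Y" and "card Y = k" and "Y \<subseteq> {1..n}"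
    using assms by (auto simp: ahlswede_khachatrian_def with_trace_def star_def nsets_def)
qed

text \<open>
  A member avoiding \<open>1\<close> contains \<open>3\<close> and \<open>4\<close>.  So \<open>X - {1, 3}\<close> or \<open>X - {1, 4}\<close> is missing in \<open>X\<close>
  when \<open>X\<close> contains \<open>1\<close> and \<open>3\<close>, or \<open>1\<close> and \<open>4\<close>.  In the other two cases a member with the given trace
  on \<open>X\<close> would have more than \<open>k\<close> points: it contains \<open>X - {1}\<close> and \<open>{3, 4}\<close> in the first, and in the
  second it contains \<open>X - {2, 3}\<close> and \<open>1\<close>, hence also \<open>2\<close>, as it has \<open>4\<close> but not \<open>3\<close> and the trace
  \<open>{1, 4}\<close> does not occur.
\<close>
lemma ahlswede_khachatrian_unshattered:
  assumes X: "X \<in> ahlswede_khachatrian n k"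
  shows "\<exists>B\<subset>X. \<forall>Y\<in>ahlswede_khachatrian n k. Y \<inter> X \<noteq> B"
proof -
  note t = ahlswede_khachatrian_trace
  consider "1 \<in> X" "3 \<in> X" | "1 \<in> X" "4 \<in> X" | "1 \<in> X" "3 \<notin> X" "4 \<notin> X" | "1 \<notin> X" by blast
  then show ?thesis
  proof cases
    case 1
    then show ?thesis using t(2) by (intro exI[of _ "X - {1, 3}"]) blast
  next
    case 2
    then show ?thesis using t(2) by (intro exI[of _ "X - {1, 4}"]) blast
  next
    case 3
    have "Y \<inter> X \<noteq> X - {1}" if Y: "Y \<in> ahlswede_khachatrian n k" for Y
    proof
      assume eq: "Y \<inter> X = X - {1}"
      then have "1 \<notin> Y" using 3 by blast
      then have "insert 3 (insert 4 (X - {1})) \<subseteq> Y" using t(2)[OF Y] eq by blast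
      then have "card (insert 3 (insert 4 (X - {1}))) \<le> card Y" using t(3)[OF Y] by (rule card_mono[rotated])
      moreover have "card (insert 3 (insert 4 (X - {1}))) = Suc (card X)"
        using 3 t(3)[OF X] card_Suc_Diff1[of X 1] by simp
      ultimately show False using t(4)[OF Y] t(4)[OF X] by simp
    qed
    then show ?thesis using 3 by (intro exI[of _ "X - {1}"]) blast
  next
    case 4
    have X34: "3 \<in> X" "4 \<in> X" using t(2)[OF X 4] by auto
    have "Y \<inter> X \<noteq> X - {2, 3}" if Y: "Y \<in> ahlswede_khachatrian n k" for Y
    proof
      assume eq: "Y \<inter> X = X - {2, 3}"
      have mem: "v \<in> Y \<longleftrightarrow> v \<notin> {2, 3}" if "v \<in> X" for v
      proof -
        have "v \<in> Y \<longleftrightarrow> v \<in> Y \<inter> X" using that by simp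
        then show ?thesis unfolding eq using that by simp
      qed
      have Y3: "3 \<notin> Y" "4 \<in> Y" using mem[OF X34(1)] mem[OF X34(2)] by simp_all
      then have Y1: "1 \<in> Y" using t(2)[OF Y] by blast
      then have Y2: "2 \<in> Y" using t(1)[OF Y] Y3 by blast
      then have X2: "2 \<notin> X" using mem[of 2] by auto
      have "v \<in> Y" if "v \<in> X - {3}" for v using mem[of v] that X2 by auto
      then have "insert 1 (insert 2 (X - {3})) \<subseteq> Y" using Y1 Y2 by simp blast
      then have "card (insert 1 (insert 2 (X - {3}))) \<le> card Y" using t(3)[OF Y] by (rule card_mono[rotated])
      moreover have "card (insert 1 (insert 2 (X - {3}))) = Suc (card X)"
        using 4 X2 X34 t(3)[OF X] card_Suc_Diff1[of X 3] by simp
      ultimately show False using t(4)[OF Y] t(4)[OF X] by simp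
    qed
    then show ?thesis using X34 by (intro exI[of _ "X - {2, 3}"]) blast
  qed
qed

lemma card_ahlswede_khachatrian:
  assumes "n \<ge> 4" and "d \<ge> 2"
  shows "card (ahlswede_khachatrian n (Suc d)) = ((n - 1) choose d) + ((n - 4) choose (d - 2))"
proof -
  let ?w = "with_trace n (Suc d)"
  have fin: "finite (nsets {1..n} (Suc d))" by (simp add: finite_imp_finite_nsets)
  have fs: "finite (star n (Suc d))" and fw: "finite (?w T)" for T
    using fin by (auto simp: star_def with_trace_def)
  have c: "card (?w {1, 4}) = card (?w {3, 4})" using assms by (simp add: card_with_trace)
  have "Suc d - card {2, 3, 4 :: nat} = d - 2" by (simp add: numeral_2_eq_2)
  then have c': "card (?w {2, 3, 4}) = (n - 4) choose (d - 2)"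
    using card_with_trace[of "{2, 3, 4}" n "Suc d"] assms by simp
  have dis: "X \<notin> ?w {3, 4}" "X \<notin> ?w {2, 3, 4}" if "X \<in> star n (Suc d)" for X
    using that with_trace_mem[of X n "Suc d" "{3, 4}" 1] with_trace_mem[of X n "Suc d" "{2, 3, 4}" 1]
    by (auto simp: star_def)
  have dis': "X \<notin> ?w {2, 3, 4}" if "X \<in> ?w {3, 4}" for X
    using with_trace_mem[OF that, of 2] with_trace_mem[of X n "Suc d" "{2, 3, 4}" 2] by auto
  have "?w {1, 4} \<subseteq> star n (Suc d)" by (auto simp: star_def with_trace_def)
  then have "card (star n (Suc d) - ?w {1, 4}) + card (?w {1, 4}) = card (star n (Suc d))"
    using fs fw by (simp add: card_Diff_subset card_mono)
  moreover have "card ((star n (Suc d) - ?w {1, 4}) \<union> ?w {3, 4}) = card (star n (Suc d) - ?w {1, 4}) + card (?w {3, 4})"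
    using fs fw dis by (intro card_Un_disjoint) auto
  moreover have "card (ahlswede_khachatrian n (Suc d))
    = card ((star n (Suc d) - ?w {1, 4}) \<union> ?w {3, 4}) + card (?w {2, 3, 4})"
    unfolding ahlswede_khachatrian_def using fs fw dis dis' by (intro card_Un_disjoint) auto
  ultimately show ?thesis using c c' card_star[of n d] assms by simp
qed

text \<open>
  For \<open>d = 1\<close> or \<open>n < 4\<close> the second binomial coefficient vanishes, and the star suffices.
\<close>
lemma vc_dim_le_family_of_large_size:
  assumes "d \<ge> 1" and "n \<ge> 1"
  obtains G where "G \<subseteq> nsets {1..n} (d + 1)" and "vc_dim n G \<le> d"
    and "card G = binom (int n - 1) (int d) + binom (int n - 4) (int d - 2)"
proof -
  have b1: "binom (int n - 1) (int d) = (n - 1) choose d"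
    using assms by (auto simp: binom_def nat_diff_distrib binomial_eq_0)
  show thesis
  proof (cases "d \<ge> 2 \<and> n \<ge> 4")
    case True
    let ?G = "ahlswede_khachatrian n (Suc d)"
    have "binom (int n - 4) (int d - 2) = (n - 4) choose (d - 2)"
      using True by (auto simp: binom_def nat_diff_distrib binomial_eq_0)
    then have "card ?G = binom (int n - 1) (int d) + binom (int n - 4) (int d - 2)"
      using b1 card_ahlswede_khachatrian True by simp
    moreover have sub: "?G \<subseteq> nsets {1..n} (d + 1)"
    proof
      fix Y assume "Y \<in> ?G"
      from ahlswede_khachatrian_trace(3-5)[OF this] show "Y \<in> nsets {1..n} (d + 1)" by (simp add: nsets_def)
    qed
    moreover have "vc_dim n ?G \<le> d"
      unfolding vc_dim_uniform_le_iff[OF sub] by (intro ballI ahlswede_khachatrian_unshattered)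
    ultimately show thesis using that by blast
  next
    case False
    let ?G = "star n (Suc d)"
    have "binom (int n - 4) (int d - 2) = 0" using False by (auto simp: binom_def)
    then have "card ?G = binom (int n - 1) (int d) + binom (int n - 4) (int d - 2)"
      using b1 card_star assms by simp
    moreover have sub: "?G \<subseteq> nsets {1..n} (d + 1)" by (auto simp: star_def)
    moreover have "vc_dim n ?G \<le> d"
      unfolding vc_dim_uniform_le_iff[OF sub] by (intro ballI star_unshattered)
    ultimately show thesis using that by blast
  qed
qed

section \<open>The maximum size\<close>

theorem theorem1p1:
  fixes d :: nat
  assumes "d \<ge> 1"
  shows "\<exists>C::real. \<forall>n::nat. n \<ge> 1 \<longrightarrow> (\<forall>F.
    is_arg_max card (\<lambda>F. F \<subseteq> nsets {1..n} (d + 1) \<and> vc_dim n F \<le> d) F \<longrightarrow>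
      binom (int n - 1) (int d) + binom (int n - 4) (int d - 2) \<le> card F \<and>
      real (card F) \<le> real (binom (int n - 1) (int d)) + C * real n powi (int d - 2))"
proof (rule exI[of _ "real (uniform_vc_family.error_factor d)"], intro allI impI conjI)
  fix n :: nat and F
  assume n: "n \<ge> 1"
    and max: "is_arg_max card (\<lambda>F. F \<subseteq> nsets {1..n} (d + 1) \<and> vc_dim n F \<le> d) F"
  obtain G where "G \<subseteq> nsets {1..n} (d + 1)" "vc_dim n G \<le> d"
    "card G = binom (int n - 1) (int d) + binom (int n - 4) (int d - 2)"
    using vc_dim_le_family_of_large_size[OF assms n] .
  then show "binom (int n - 1) (int d) + binom (int n - 4) (int d - 2) \<le> card F"
    using max by (auto simp: is_arg_max_linorder)
  have F: "F \<subseteq> nsets {1..n} (d + 1)" and "vc_dim n F \<le> d"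
    using max by (auto simp: is_arg_max_linorder)
  then have miss: "\<forall>X\<in>F. \<exists>B\<subset>X. \<forall>Y\<in>F. Y \<inter> X \<noteq> B" by (simp only: vc_dim_uniform_le_iff)
  interpret uniform_vc_family "{1..n}" d F
    by (unfold_locales) (simp, rule assms, rule F, rule bspec[OF miss])
  have b: "binom (int n - 1) (int d) = (n - 1) choose d"
    using n by (auto simp: binom_def nat_diff_distrib binomial_eq_0)
  have "n * card F \<le> n * ((n - 1) choose d) + error_factor * n ^ (d - 1)"
    using card_upper_bound n by simp
  then have "real (n * card F) \<le> real (n * ((n - 1) choose d) + error_factor * n ^ (d - 1))"
    by (rule of_nat_mono)
  then have "real n * real (card F) \<le> real n * real ((n - 1) choose d) + real error_factor * real n ^ (d - 1)"
    by simp
  moreover have "real n ^ (d - 1) = real n * real n powi (int d - 2)"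
  proof -
    obtain k where k: "d = Suc k" using assms by (cases d) auto
    then have "int d - 2 = int k - 1" by simp
    then have "real n powi (int d - 2) = real n powi int k / real n powi 1"
      using n power_int_diff[of "real n" "int k" 1] by simp
    then show ?thesis using n k by simp
  qed
  ultimately have "real n * real (card F)
      \<le> real n * (real ((n - 1) choose d) + real error_factor * real n powi (int d - 2))"
    by (simp add: algebra_simps)
  then show "real (card F) \<le> real (binom (int n - 1) (int d)) + real error_factor * real n powi (int d - 2)"
    using n b by simp
qed

end
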